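(* Let $\mathbf u:[0,T]\to\mathbb R^N$ solve the semi-discrete approximation described in the context with $\sigma(x_i)\neq0$ for all $i=1,\dots,N$, penalty parameters $\tau_L=-\tau_R=1$ and homogeneous boundary data $\mathbf b_L=\mathbf b_R=\mathbf 0$. If the real boundary parameters satisfy $\alpha_L^2+\beta_L^2\ne0$, $\alpha_R^2+\beta_R^2\ne0$, $\alpha_L\beta_L\le0$, $\alpha_R\beta_R\ge0$ and $\alpha_L,\alpha_R$ are nonzero, then the semi-discrete energy satisfies $$\mathcal E(t)+\int_0^t\operatorname{BT}_h(s)\,ds\le\mathcal E(0)+\frac1\delta\int_0^t\|\mathbf c^{-1}\mathbf S(s)\|_{H_x}^2\,ds\qquad\forall t\in[0,T],$$ where $\delta=2\min_{1\le i\le N}(\sigma(x_i))^2$ and $\operatorname{BT}_h(t)=\frac{\beta_R}{\alpha_R}\left(\frac{du_N}{dt}\right)^2-\frac{\beta_L}{\alpha_L}\left(\frac{du_1}{dt}\right)^2$.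
   Context: Space grid: $\Omega=[x_L,x_R]$, uniform points $x_1=x_L,\dots,x_N=x_R$, $\Delta x=(x_R-x_L)/(N-1)$. A triplet $(D_x^-,D_x^+,H_x)$ of $N\times N$ matrices satisfies the DP-SBP framework if: (A.1) $H_x=\operatorname{diag}(h_1\Delta x,\dots,h_N\Delta x)$ is diagonal and positive definite, defines $(\mathbf f,\mathbf g)_{H_x}=\mathbf f^\top H_x\mathbf g$ and $\|\mathbf f\|_{H_x}^2=(\mathbf f,\mathbf f)_{H_x}$, and $(\mathbf 1,\mathbf f)_{H_x}=\sum_i h_if(x_i)\Delta x$ is a quadrature converging to $\int_\Omega f\,dx$ as $N\to\infty$; (A.2) $D_x^\pm$ differentiate grid restrictions of polynomials of degree at most $p$ exactly; (A.3) $(D_x^+\mathbf f,\mathbf g)_{H_x}+(\mathbf f,D_x^-\mathbf g)_{H_x}=f_Ng_N-f_1g_1$ for all $\mathbf f,\mathbf g\in\mathbb R^N$; (A.4) $(\mathbf f,(D_x^+-D_x^-)\mathbf f)_{H_x}\le 0$ for all $\mathbf f$. Let $(D_x^-,D_x^+,H_x)$ be such a triplet. $\mathbf c=\operatorname{diag}(c(x_1),\dots,c(x_N))$ with $c(x)\neq0$, $\pmb\sigma=\operatorname{diag}(\sigma(x_1),\dots,\sigma(x_N))$ (real); $e_1,e_N\in\mathbb R^N$ are the first and last standard basis vectors; $\mathbf S(t)\in\mathbb R^N$ is the (continuous in time) source grid function; $\mathbf b_L(t)=b_L(t)e_1$, $\mathbf b_R(t)=b_R(t)e_N$ are boundary data;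 $\mathbf f,\mathbf g\in\mathbb R^N$ are initial data. The semi-discrete approximation is $$\frac{d^2\mathbf u}{dt^2}+\pmb\sigma^2\frac{d\mathbf u}{dt}=\mathbf c^2D_x^+D_x^-\mathbf u+\mathbf S(t)+\tau_L\mathbf c^2H_x^{-1}e_1e_1^\top\left(D_x^-\mathbf u+\frac{\beta_L}{\alpha_L}\frac{d\mathbf u}{dt}-\frac1{\alpha_L}\mathbf b_L(t)\right)+\tau_R\mathbf c^2H_x^{-1}e_Ne_N^\top\left(D_x^-\mathbf u+\frac{\beta_R}{\alpha_R}\frac{d\mathbf u}{dt}-\frac1{\alpha_R}\mathbf b_R(t)\right),$$ $\mathbf u(0)=\mathbf f$, $\frac{d\mathbf u}{dt}|_{t=0}=\mathbf g$, for $t\in[0,T]$. The semi-discrete energy is $\mathcal E(t)=\frac12\left(\left\|\mathbf c^{-1}\frac{d\mathbf u}{dt}\right\|_{H_x}^2+\|D_x^-\mathbf u\|_{H_x}^2\right)$. *)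

theory Defs
  imports
    "HOL-Analysis.Henstock_Kurzweil_Integration"
    "HOL-Computational_Algebra.Polynomial"
    "Jordan_Normal_Form.Gauss_Jordan_Elimination"
begin

unbundle no inner_syntax

text \<open>
  Since the quadrature axiom is a statement about \<open>N \<longrightarrow> \<infinity>\<close>, the grid size must be a value rather
  than a type; hence the vectors and matrices of the Jordan normal form library.  Their indices
  start at \<open>0\<close>: the grid point \<open>x\<^sub>1\<close> has index \<open>0\<close> and \<open>x\<^sub>N\<close> has index \<open>N - 1\<close>.
\<close>

subsection \<open>Grids\<close>

definition grid_step :: "real \<Rightarrow> real \<Rightarrow> nat \<Rightarrow> real" where
  "grid_step xL xR N = (xR - xL) / (real N - 1)"

definition grid_pt :: "real \<Rightarrow> real \<Rightarrow> nat \<Rightarrow> nat \<Rightarrow> real" where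
  "grid_pt xL xR N i = xL + real i * grid_step xL xR N"

definition grid_fun :: "real \<Rightarrow> real \<Rightarrow> nat \<Rightarrow> (real \<Rightarrow> real) \<Rightarrow> real vec" where
  "grid_fun xL xR N \<phi> = vec N (\<lambda>i. \<phi> (grid_pt xL xR N i))"

definition grid_diag :: "real \<Rightarrow> real \<Rightarrow> nat \<Rightarrow> (real \<Rightarrow> real) \<Rightarrow> real mat" where
  "grid_diag xL xR N \<phi> = mat_diag N (\<lambda>i. \<phi> (grid_pt xL xR N i))"

text \<open>Only used for invertible matrices; see the lemma for the case of diagonal ones.\<close>

definition mat_inv :: "real mat \<Rightarrow> real mat" where
  "mat_inv A = the (mat_inverse A)"

lemma mat_inv_mat_diag:
  fixes d :: "nat \<Rightarrow> real"
  assumes "\<And>i. i < n \<Longrightarrow> d i \<noteq> 0"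
  shows "mat_inv (mat_diag n d) = mat_diag n (\<lambda>i. 1 / d i)"
proof -
  let ?A = "mat_diag n d" and ?B = "mat_diag n (\<lambda>i. 1 / d i)"
  have A: "?A \<in> carrier_mat n n" and B: "?B \<in> carrier_mat n n" by simp_all
  have one: "?A * ?B = 1\<^sub>m n" "?B * ?A = 1\<^sub>m n"
    unfolding mat_diag_diag using assms by (auto simp: mat_diag_def)
  have "?A \<in> Units (ring_mat TYPE(real) n ())"
    using A B one unfolding Units_def by (auto simp: ring_mat_def simp del: mat_diag_diag intro!: bexI[of _ ?B])
  then obtain C where C: "mat_inverse ?A = Some C"
    using mat_inverse(1)[OF A, where b = "()"] by (cases "mat_inverse ?A") auto
  from mat_inverse(2)[OF A C] have CA: "C * ?A = 1\<^sub>m n" and Cc: "C \<in> carrier_mat n n" by auto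
  have "C = C * (?A * ?B)" using one Cc by simp
  also have "\<dots> = (C * ?A) * ?B" using assoc_mult_mat[OF Cc A B] by simp
  also have "\<dots> = ?B" unfolding CA by (rule left_mult_one_mat[OF B])
  finally show ?thesis by (simp add: mat_inv_def C)
qed

subsection \<open>The dual-pairing SBP framework\<close>

definition inner_H :: "real mat \<Rightarrow> real vec \<Rightarrow> real vec \<Rightarrow> real" where
  "inner_H H f g = f \<bullet> (H *\<^sub>v g)"

definition norm_H :: "real mat \<Rightarrow> real vec \<Rightarrow> real" where
  "norm_H H f = sqrt (inner_H H f f)"

definition pos_def_mat :: "nat \<Rightarrow> real mat \<Rightarrow> bool" where
  "pos_def_mat N H \<longleftrightarrow> (\<forall>f\<in>carrier_vec N. f \<noteq> 0\<^sub>v N \<longrightarrow> f \<bullet> (H *\<^sub>v f) > 0)"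

definition differentiates_polys :: "real \<Rightarrow> real \<Rightarrow> nat \<Rightarrow> nat \<Rightarrow> real mat \<Rightarrow> bool" where
  "differentiates_polys xL xR p N D \<longleftrightarrow>
     (\<forall>q :: real poly. degree q \<le> p \<longrightarrow>
        D *\<^sub>v grid_fun xL xR N (poly q) = grid_fun xL xR N (poly (pderiv q)))"

definition dp_sbp_at ::
  "real \<Rightarrow> real \<Rightarrow> nat \<Rightarrow> nat \<Rightarrow> real mat \<Rightarrow> real mat \<Rightarrow> real mat \<Rightarrow> bool" where
  "dp_sbp_at xL xR p N Dm Dp H \<longleftrightarrow>
     Dm \<in> carrier_mat N N \<and> Dp \<in> carrier_mat N N \<and>
     (\<exists>h. H = mat_diag N (\<lambda>i. h i * grid_step xL xR N)) \<and> pos_def_mat N H \<and>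
     differentiates_polys xL xR p N Dm \<and> differentiates_polys xL xR p N Dp \<and>
     (\<forall>f\<in>carrier_vec N. \<forall>g\<in>carrier_vec N.
        inner_H H (Dp *\<^sub>v f) g + inner_H H f (Dm *\<^sub>v g)
          = f $ (N - 1) * g $ (N - 1) - f $ 0 * g $ 0) \<and>
     (\<forall>f\<in>carrier_vec N. inner_H H f ((Dp - Dm) *\<^sub>v f) \<le> 0)"

text \<open>
  The set \<open>Ns\<close> collects the grid sizes for which the scheme is defined.  The limit
  \<open>N \<longrightarrow> \<infinity>\<close> is taken along \<open>Ns\<close>.
\<close>

definition dp_sbp ::
  "real \<Rightarrow> real \<Rightarrow> nat \<Rightarrow> nat set \<Rightarrow>
   (nat \<Rightarrow> real mat) \<Rightarrow> (nat \<Rightarrow> real mat) \<Rightarrow> (nat \<Rightarrow> real mat) \<Rightarrow> bool" where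
  "dp_sbp xL xR p Ns Dm Dp H \<longleftrightarrow>
     infinite Ns \<and> (\<forall>N\<in>Ns. 2 \<le> N) \<and>
     (\<forall>N\<in>Ns. dp_sbp_at xL xR p N (Dm N) (Dp N) (H N)) \<and>
     (\<forall>\<phi>. continuous_on {xL..xR} \<phi> \<longrightarrow>
        ((\<lambda>N. inner_H (H N) (grid_fun xL xR N (\<lambda>_. 1)) (grid_fun xL xR N \<phi>))
           \<longlongrightarrow> integral {xL..xR} \<phi>) (inf sequentially (principal Ns)))"

subsection \<open>The semi-discrete problem\<close>

text \<open>Componentwise time derivative on \<open>[0,T]\<close>, one-sided at the end points.\<close>

definition ddt :: "nat \<Rightarrow> real \<Rightarrow> (real \<Rightarrow> real vec) \<Rightarrow> real \<Rightarrow> real vec" where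
  "ddt N T u t = vec N (\<lambda>i. vector_derivative (\<lambda>s. u s $ i) (at t within {0..T}))"

definition vec_differentiable :: "nat \<Rightarrow> real \<Rightarrow> (real \<Rightarrow> real vec) \<Rightarrow> bool" where
  "vec_differentiable N T u \<longleftrightarrow> (\<forall>i<N. (\<lambda>s. u s $ i) differentiable_on {0..T})"

text \<open>
  The penalty term \<open>\<tau> c\<^sup>2 H\<^sup>-\<^sup>1 e e\<^sup>T (D\<^sup>- u + (\<beta>/\<alpha>) du/dt - (1/\<alpha>) b e)\<close> at the boundary node with
  index \<open>k\<close>, where \<open>e\<close> is the corresponding unit vector, \<open>b\<close> the scalar boundary datum, and
  \<open>v\<close> stands for \<open>du/dt\<close>.
\<close>

definition sat_term ::
  "nat \<Rightarrow> real mat \<Rightarrow> real mat \<Rightarrow> real mat \<Rightarrow> nat \<Rightarrow> real \<Rightarrow> real \<Rightarrow> real \<Rightarrow> real \<Rightarrow>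
   real vec \<Rightarrow> real vec \<Rightarrow> real vec" where
  "sat_term N Dm H C k \<tau> \<alpha> \<beta> b u v =
     (let e = unit_vec N k in
      \<tau> \<cdot>\<^sub>v ((C ^\<^sub>m 2) *\<^sub>v (mat_inv H *\<^sub>v
        ((e \<bullet> (Dm *\<^sub>v u + (\<beta> / \<alpha>) \<cdot>\<^sub>v v - (1 / \<alpha>) \<cdot>\<^sub>v (b \<cdot>\<^sub>v e))) \<cdot>\<^sub>v e))))"

text \<open>\<open>C\<close> and \<open>\<Sigma>\<close> are the diagonal matrices of the wave speed and of the damping coefficient.\<close>

definition semi_discrete_solution ::
  "nat \<Rightarrow> real mat \<Rightarrow> real mat \<Rightarrow> real mat \<Rightarrow> real mat \<Rightarrow> real mat \<Rightarrow>
   real \<Rightarrow> real \<Rightarrow> real \<Rightarrow> real \<Rightarrow> real \<Rightarrow> real \<Rightarrow>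
   (real \<Rightarrow> real vec) \<Rightarrow> (real \<Rightarrow> real) \<Rightarrow> (real \<Rightarrow> real) \<Rightarrow> real vec \<Rightarrow> real vec \<Rightarrow>
   real \<Rightarrow> (real \<Rightarrow> real vec) \<Rightarrow> bool" where
  "semi_discrete_solution N Dm Dp H C \<Sigma> \<tau>L \<tau>R \<alpha>L \<beta>L \<alpha>R \<beta>R S bL bR f g T u \<longleftrightarrow>
     (\<forall>t\<in>{0..T}. u t \<in> carrier_vec N) \<and>
     vec_differentiable N T u \<and> vec_differentiable N T (ddt N T u) \<and>
     (\<forall>t\<in>{0..T}.
        ddt N T (ddt N T u) t + (\<Sigma> ^\<^sub>m 2) *\<^sub>v ddt N T u t
          = (C ^\<^sub>m 2) *\<^sub>v (Dp *\<^sub>v (Dm *\<^sub>v u t)) + S t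
            + sat_term N Dm H C 0 \<tau>L \<alpha>L \<beta>L (bL t) (u t) (ddt N T u t)
            + sat_term N Dm H C (N - 1) \<tau>R \<alpha>R \<beta>R (bR t) (u t) (ddt N T u t)) \<and>
     u 0 = f \<and> ddt N T u 0 = g"

definition semi_discrete_energy ::
  "nat \<Rightarrow> real mat \<Rightarrow> real mat \<Rightarrow> real mat \<Rightarrow> real \<Rightarrow> (real \<Rightarrow> real vec) \<Rightarrow> real \<Rightarrow> real" where
  "semi_discrete_energy N Dm H C T u t =
     1 / 2 * ((norm_H H (mat_inv C *\<^sub>v ddt N T u t))\<^sup>2 + (norm_H H (Dm *\<^sub>v u t))\<^sup>2)"

definition boundary_term ::
  "nat \<Rightarrow> real \<Rightarrow> real \<Rightarrow> real \<Rightarrow> real \<Rightarrow> real \<Rightarrow> (real \<Rightarrow> real vec) \<Rightarrow> real \<Rightarrow> real" where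
  "boundary_term N \<alpha>L \<beta>L \<alpha>R \<beta>R T u t =
     \<beta>R / \<alpha>R * (ddt N T u t $ (N - 1))\<^sup>2 - \<beta>L / \<alpha>L * (ddt N T u t $ 0)\<^sup>2"

end

theory Submission
  imports Defs
begin

text \<open>
  Differentiating the energy, the summation-by-parts property (A.3) together with the penalty
  terms for \<open>\<tau>\<^sub>L = -\<tau>\<^sub>R = 1\<close> cancels every product of \<open>du/dt\<close> with \<open>D\<^sup>- u\<close> at the boundary, so that
  \<open>E' + BT\<^sub>h = (c\<^sup>-\<^sup>1 u', c\<^sup>-\<^sup>1 S)\<^sub>H - \<parallel>\<sigma> c\<^sup>-\<^sup>1 u'\<parallel>\<^sub>H\<^sup>2\<close>.  Young's inequality at each grid point absorbs
  the first term into the damping, and integration in time gives the estimate.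
\<close>

unbundle no vec_syntax

section \<open>Diagonal matrices and the weighted inner product\<close>

lemma mat_diag_mult_vec:
  fixes x :: "'a :: comm_ring_1 vec"
  assumes "x \<in> carrier_vec n"
  shows "mat_diag n d *\<^sub>v x = vec n (\<lambda>i. d i * x $ i)"
proof (rule eq_vecI)
  fix i assume "i < dim_vec (vec n (\<lambda>i. d i * x $ i))"
  then have i: "i < n" by simp
  have "(mat_diag n d *\<^sub>v x) $ i = (\<Sum>j\<in>{0..<n}. (if i = j then d j else 0) * x $ j)"
    using i assms by (simp add: mat_diag_def scalar_prod_def)
  also have "\<dots> = (\<Sum>j\<in>{0..<n}. if j = i then d i * x $ i else 0)"
    by (intro sum.cong) auto
  also have "\<dots> = d i * x $ i" using i by simp
  finally show "(mat_diag n d *\<^sub>v x) $ i = vec n (\<lambda>i. d i * x $ i) $ i" using i by simp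
qed (simp add: mat_diag_def)

lemma mat_diag_pow2: "mat_diag n (d :: nat \<Rightarrow> 'a :: comm_ring_1) ^\<^sub>m 2 = mat_diag n (\<lambda>i. (d i)\<^sup>2)"
  by (simp add: numeral_2_eq_2 power2_eq_square)

lemma inner_H_mat_diag:
  assumes "f \<in> carrier_vec n" "g \<in> carrier_vec n"
  shows "inner_H (mat_diag n w) f g = (\<Sum>i<n. w i * f $ i * g $ i)"
  using assms
  by (auto simp: inner_H_def mat_diag_mult_vec scalar_prod_def lessThan_atLeast0 mult_ac intro!: sum.cong)

text \<open>Testing the quadratic form on the unit vector of index \<open>i\<close> isolates
  \<open>w i\<close>.\<close>

lemma pos_def_mat_diag_pos:
  assumes "pos_def_mat n (mat_diag n w)" "i < n"
  shows "0 < w i"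
proof -
  have "unit_vec n i $ i \<noteq> (0\<^sub>v n :: real vec) $ i" using assms(2) by simp
  then have "unit_vec n i \<noteq> (0\<^sub>v n :: real vec)" by metis
  then have "0 < inner_H (mat_diag n w) (unit_vec n i) (unit_vec n i)"
    using assms(1) by (auto simp: pos_def_mat_def inner_H_def)
  also have "\<dots> = (\<Sum>j<n. if j = i then w i else 0)"
    using assms(2) by (simp add: inner_H_mat_diag if_distrib cong: if_cong)
  also have "\<dots> = w i" using assms(2) by simp
  finally show ?thesis .
qed

text \<open>Squaring the root in \<open>norm_H\<close> gives back the inner product only if that is
  nonnegative; hence the sign condition on the weights.\<close>

lemma norm_H_mat_diag_sq:
  assumes "f \<in> carrier_vec n" "\<And>i. i < n \<Longrightarrow> 0 \<le> w i"
  shows "(norm_H (mat_diag n w) f)\<^sup>2 = (\<Sum>i<n. w i * (f $ i)\<^sup>2)"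
proof -
  have "0 \<le> (\<Sum>i<n. w i * (f $ i)\<^sup>2)" using assms(2) by (intro sum_nonneg) auto
  then show ?thesis
    unfolding norm_H_def by (simp add: inner_H_mat_diag assms(1) power2_eq_square mult.assoc)
qed

section \<open>Time derivatives of grid functions\<close>

lemma ddt_carrier [simp]: "ddt N T u t \<in> carrier_vec N"
  by (simp add: ddt_def)

text \<open>\<open>ddt\<close> rests on the choice operator \<open>vector_derivative\<close>, whose
  value is known to be a derivative only once differentiability is.\<close>

lemma vec_differentiable_has_vector_derivative:
  assumes "vec_differentiable N T u" "i < N" "t \<in> {0..T}"
  shows "((\<lambda>s. u s $ i) has_vector_derivative ddt N T u t $ i) (at t within {0..T})"
proof -
  have "(\<lambda>s. u s $ i) differentiable (at t within {0..T})"
    using assms by (auto simp: vec_differentiable_def differentiable_on_def)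
  then show ?thesis using assms(2) by (simp add: vector_derivative_works ddt_def)
qed

lemma mult_mat_vec_has_vector_derivative:
  fixes u :: "real \<Rightarrow> real vec"
  assumes "A \<in> carrier_mat m n" "i < m" "t \<in> X"
    and "\<And>s. s \<in> X \<Longrightarrow> u s \<in> carrier_vec n" "v \<in> carrier_vec n"
    and "\<And>j. j < n \<Longrightarrow> ((\<lambda>s. u s $ j) has_vector_derivative v $ j) (at t within X)"
  shows "((\<lambda>s. (A *\<^sub>v u s) $ i) has_vector_derivative (A *\<^sub>v v) $ i) (at t within X)"
proof -
  have comp: "(A *\<^sub>v x) $ i = (\<Sum>j<n. A $$ (i, j) * x $ j)" if "x \<in> carrier_vec n" for x
    using assms(1,2) that by (auto simp: scalar_prod_def lessThan_atLeast0 intro!: sum.cong)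
  have "((\<lambda>s. \<Sum>j<n. A $$ (i, j) * u s $ j) has_vector_derivative
      (\<Sum>j<n. A $$ (i, j) * v $ j)) (at t within X)"
    using assms(6) by (intro has_vector_derivative_sum has_vector_derivative_mult_right) auto
  then show ?thesis
    unfolding comp[OF assms(5)]
    \<comment> \<open>Off \<open>X\<close> the vector \<open>u s\<close> may have the wrong
      dimension, so \<open>comp\<close> applies only inside \<open>X\<close>; this suffices for a
      derivative within \<open>X\<close>.\<close>
    by (rule has_vector_derivative_transform[OF assms(3), rotated]) (simp add: comp assms(4))
qed

section \<open>Penalty terms and the rate of change of the energy\<close>

lemma sat_term_index:
  assumes "H = mat_diag N w" "\<And>i. i < N \<Longrightarrow> 0 < w i" "C = mat_diag N d"
    and "Dm \<in> carrier_mat N N" "u \<in> carrier_vec N" "v \<in> carrier_vec N" "k < N" "i < N"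
  shows "sat_term N Dm H C k \<tau> \<alpha> \<beta> 0 u v $ i
    = (if i = k then \<tau> * (d i)\<^sup>2 / w i * ((Dm *\<^sub>v u) $ k + \<beta> / \<alpha> * v $ k) else 0)"
proof -
  have inv: "mat_inv H = mat_diag N (\<lambda>i. 1 / w i)"
    unfolding assms(1) using assms(2) by (intro mat_inv_mat_diag) (metis less_irrefl)
  \<comment> \<open>The product with the unit vector reads off entry \<open>k\<close> of the
    bracket; as \<open>H\<close> and \<open>C\<close> are diagonal, the penalty stays at that
    node.\<close>
  have "unit_vec N k \<bullet> (Dm *\<^sub>v u + (\<beta> / \<alpha>) \<cdot>\<^sub>v v - (1 / \<alpha>) \<cdot>\<^sub>v (0 \<cdot>\<^sub>v unit_vec N k))
      = (Dm *\<^sub>v u) $ k + \<beta> / \<alpha> * v $ k"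
    using assms(4-7) by (subst scalar_prod_left_unit) auto
  then show ?thesis
    unfolding sat_term_def Let_def inv
    unfolding assms(3) mat_diag_pow2 using assms(7,8) by (auto simp: mat_diag_mult_vec unit_vec_def)
qed

text \<open>Pure algebra at one instant: \<open>v\<close> and \<open>a\<close> stand for the first
  and second time derivatives of \<open>u\<close>. Equation \<open>i\<close> is multiplied by
  \<open>w i * v $ i / (d i)\<^sup>2\<close> and summed over the grid.\<close>

lemma semi_discrete_energy_rate:
  assumes H: "H = mat_diag N w" and w: "\<And>i. i < N \<Longrightarrow> 0 < w i"
    and C: "C = mat_diag N d" and d: "\<And>i. i < N \<Longrightarrow> d i \<noteq> 0"
    and \<Sigma>: "\<Sigma> = mat_diag N s"
    and Dm: "Dm \<in> carrier_mat N N" and Dp: "Dp \<in> carrier_mat N N"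
    and sbp: "\<And>f g. f \<in> carrier_vec N \<Longrightarrow> g \<in> carrier_vec N \<Longrightarrow>
        inner_H H (Dp *\<^sub>v f) g + inner_H H f (Dm *\<^sub>v g)
          = f $ (N - 1) * g $ (N - 1) - f $ 0 * g $ 0"
    and N: "0 < N"
    and u: "u \<in> carrier_vec N" and v: "v \<in> carrier_vec N"
    and a: "a \<in> carrier_vec N" and S: "S \<in> carrier_vec N"
    and ode: "a + (\<Sigma> ^\<^sub>m 2) *\<^sub>v v = (C ^\<^sub>m 2) *\<^sub>v (Dp *\<^sub>v (Dm *\<^sub>v u)) + S
            + sat_term N Dm H C 0 1 \<alpha>L \<beta>L 0 u v + sat_term N Dm H C (N - 1) (- 1) \<alpha>R \<beta>R 0 u v"
  shows "(\<Sum>i<N. w i * (v $ i / d i) * (a $ i / d i))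
        + (\<Sum>i<N. w i * (Dm *\<^sub>v u) $ i * (Dm *\<^sub>v v) $ i)
        + (\<beta>R / \<alpha>R * (v $ (N - 1))\<^sup>2 - \<beta>L / \<alpha>L * (v $ 0)\<^sup>2)
      = (\<Sum>i<N. w i * ((v $ i / d i) * (S $ i / d i) - (s i)\<^sup>2 * (v $ i / d i)\<^sup>2))"
proof -
  define q where "q = Dm *\<^sub>v u"
  define r where "r = Dp *\<^sub>v q"
  have q: "q \<in> carrier_vec N" and r: "r \<in> carrier_vec N"
    using Dm Dp u by (auto simp: q_def r_def)
  define XL where "XL = q $ 0 + \<beta>L / \<alpha>L * v $ 0"
  define XR where "XR = q $ (N - 1) + \<beta>R / \<alpha>R * v $ (N - 1)"
  have satL: "sat_term N Dm H C 0 1 \<alpha>L \<beta>L 0 u v $ i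
      = (if i = 0 then (d i)\<^sup>2 / w i * XL else 0)" if "i < N" for i
    using sat_term_index[OF H w C Dm u v N that] by (simp add: XL_def q_def)
  have satR: "sat_term N Dm H C (N - 1) (- 1) \<alpha>R \<beta>R 0 u v $ i
      = (if i = N - 1 then - ((d i)\<^sup>2 / w i * XR) else 0)" if "i < N" for i
    using sat_term_index[OF H w C Dm u v _ that, of "N - 1"] N by (simp add: XR_def q_def)
  \<comment> \<open>Indexing into the sum of vectors in \<open>ode\<close> needs their dimensions;
    here the outermost factor \<open>C ^\<^sub>m 2\<close> fixes it.\<close>
  have dim: "dim_vec (sat_term N Dm H C k \<tau> \<alpha> \<beta> b u v) = N" for k \<tau> \<alpha> \<beta> b
    by (simp add: sat_term_def Let_def C mat_diag_pow2 mat_diag_def)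
  \<comment> \<open>The two boundary contributions are separate summands, so the formula also covers
    \<open>N = 1\<close>, where both fall on the same node.\<close>
  have comp: "a $ i + (s i)\<^sup>2 * v $ i = (d i)\<^sup>2 * r $ i + S $ i
      + (if i = 0 then (d i)\<^sup>2 / w i * XL else 0)
      + (if i = N - 1 then - ((d i)\<^sup>2 / w i * XR) else 0)" if i: "i < N" for i
  proof -
    have "(a + (\<Sigma> ^\<^sub>m 2) *\<^sub>v v) $ i = a $ i + (s i)\<^sup>2 * v $ i"
      using i a v by (simp add: \<Sigma> mat_diag_pow2 mat_diag_mult_vec)
    moreover have "((C ^\<^sub>m 2) *\<^sub>v (Dp *\<^sub>v (Dm *\<^sub>v u))) $ i = (d i)\<^sup>2 * r $ i"
      using i r by (simp add: C mat_diag_pow2 mat_diag_mult_vec flip: q_def r_def)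
    ultimately show ?thesis
      using arg_cong[OF ode, of "\<lambda>x. x $ i"] i S satL[OF i] satR[OF i] dim by simp
  qed
  \<comment> \<open>The multiplier cancels the factor \<open>(d i)\<^sup>2 / w i\<close> of the
    penalties and the wave speed in front of \<open>r\<close>.\<close>
  have summand: "w i * (v $ i / d i) * (a $ i / d i)
      = w i * ((v $ i / d i) * (S $ i / d i) - (s i)\<^sup>2 * (v $ i / d i)\<^sup>2) + w i * r $ i * v $ i
        + (if i = 0 then v $ 0 * XL else 0) - (if i = N - 1 then v $ (N - 1) * XR else 0)"
    if i: "i < N" for i
  proof -
    \<comment> \<open>Naming the indicator terms lets the field arithmetic run without splitting
      cases.\<close>
    define L R where "L = (if i = 0 then XL else 0)" and "R = (if i = N - 1 then XR else 0)"
    have ai: "a $ i = (d i)\<^sup>2 * r $ i + S $ i + (d i)\<^sup>2 / w i * L - (d i)\<^sup>2 / w i * R - (s i)\<^sup>2 * v $ i"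
      using comp[OF i] by (auto simp: L_def R_def)
    have "w i * (v $ i / d i) * (a $ i / d i)
      = w i * ((v $ i / d i) * (S $ i / d i) - (s i)\<^sup>2 * (v $ i / d i)\<^sup>2) + w i * r $ i * v $ i
        + v $ i * L - v $ i * R"
      unfolding ai using w[OF i] d[OF i] by (simp add: field_simps power2_eq_square)
    then show ?thesis by (auto simp: L_def R_def)
  qed
  have N1: "N - 1 < N" using N by simp
  have delta: "(\<Sum>i<N. if i = k then x else 0) = x" if "k < N" for k and x :: real
    using that by simp
  have "(\<Sum>i<N. w i * (v $ i / d i) * (a $ i / d i))
      = (\<Sum>i<N. w i * ((v $ i / d i) * (S $ i / d i) - (s i)\<^sup>2 * (v $ i / d i)\<^sup>2)
          + w i * r $ i * v $ i + (if i = 0 then v $ 0 * XL else 0)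
          - (if i = N - 1 then v $ (N - 1) * XR else 0))"
    by (rule sum.cong[OF refl], rule summand, simp)
  also have "\<dots> = (\<Sum>i<N. w i * ((v $ i / d i) * (S $ i / d i) - (s i)\<^sup>2 * (v $ i / d i)\<^sup>2))
        + (\<Sum>i<N. w i * r $ i * v $ i) + v $ 0 * XL - v $ (N - 1) * XR"
    unfolding sum.distrib sum_subtractf delta[OF N] delta[OF N1] ..
  finally have "(\<Sum>i<N. w i * (v $ i / d i) * (a $ i / d i))
      = (\<Sum>i<N. w i * ((v $ i / d i) * (S $ i / d i) - (s i)\<^sup>2 * (v $ i / d i)\<^sup>2))
        + (\<Sum>i<N. w i * r $ i * v $ i) + v $ 0 * XL - v $ (N - 1) * XR" .
  \<comment> \<open>Summation by parts with \<open>q\<close> and \<open>v\<close>. Its boundary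
    products \<open>q * v\<close> are the ones in \<open>v $ 0 * XL\<close> and
    \<open>v $ (N - 1) * XR\<close> with opposite sign, so only the squares of \<open>v\<close>
    remain.\<close>
  moreover have "(\<Sum>i<N. w i * r $ i * v $ i) + (\<Sum>i<N. w i * q $ i * (Dm *\<^sub>v v) $ i)
      = q $ (N - 1) * v $ (N - 1) - q $ 0 * v $ 0"
    using sbp[OF q v] q r v Dm by (simp add: H inner_H_mat_diag flip: r_def)
  ultimately show ?thesis
    unfolding q_def[symmetric] by (simp add: XL_def XR_def algebra_simps power2_eq_square)
qed

text \<open>Young's inequality by completing the square. The sharp constant for \<open>k = m\<close>
  is \<open>1 / (4 * m)\<close>; the added \<open>y\<^sup>2\<close> relaxes it to
  \<open>1 / (2 * m)\<close>, which is 1/\<delta> in the estimate.\<close>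

lemma mult_diff_square_le:
  fixes x y :: real
  assumes "0 < m" "m \<le> k"
  shows "x * y - k * x\<^sup>2 \<le> 1 / (2 * m) * y\<^sup>2"
proof -
  have "0 \<le> (2 * m * x - y)\<^sup>2 + y\<^sup>2" by simp
  then have "4 * m * (x * y) - 4 * m * (m * x\<^sup>2) \<le> 2 * y\<^sup>2"
    by (simp add: power2_eq_square algebra_simps)
  then have "x * y - m * x\<^sup>2 \<le> 1 / (2 * m) * y\<^sup>2" using assms(1) by (simp add: field_simps)
  moreover have "m * x\<^sup>2 \<le> k * x\<^sup>2" using assms(2) by (simp add: mult_right_mono)
  ultimately show ?thesis by linarith
qed

section \<open>The energy estimate, by integration in time\<close>

theorem corollary2:
  fixes xL xR T :: real
    and p N :: nat
    and Ns :: "nat set"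
    and Dm Dp H :: "nat \<Rightarrow> real mat"
    and c \<sigma> :: "real \<Rightarrow> real"
    and S u :: "real \<Rightarrow> real vec"
    and bL bR :: "real \<Rightarrow> real"
    and f g :: "real vec"
    and \<tau>L \<tau>R \<alpha>L \<beta>L \<alpha>R \<beta>R \<delta> :: real
    and C \<Sigma> :: "real mat"
  defines "C \<equiv> grid_diag xL xR N c"
    and "\<Sigma> \<equiv> grid_diag xL xR N \<sigma>"
    and "\<delta> \<equiv> 2 * Min ((\<lambda>i. (\<sigma> (grid_pt xL xR N i))\<^sup>2) ` {..<N})"
  assumes "xL < xR" and "0 < T"
    and "dp_sbp xL xR p Ns Dm Dp H" and "N \<in> Ns"
    and "\<And>x. x \<in> {xL..xR} \<Longrightarrow> c x \<noteq> 0"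
    and "\<And>i. i < N \<Longrightarrow> \<sigma> (grid_pt xL xR N i) \<noteq> 0"
    and "\<And>t. t \<in> {0..T} \<Longrightarrow> S t \<in> carrier_vec N"
    and "\<And>i. i < N \<Longrightarrow> continuous_on {0..T} (\<lambda>t. S t $ i)"
    and "f \<in> carrier_vec N" and "g \<in> carrier_vec N"
    and "semi_discrete_solution N (Dm N) (Dp N) (H N) C \<Sigma> \<tau>L \<tau>R \<alpha>L \<beta>L \<alpha>R \<beta>R S bL bR f g T u"
    and "\<tau>L = 1" and "\<tau>R = - 1"
    and "\<And>t. t \<in> {0..T} \<Longrightarrow> bL t = 0" and "\<And>t. t \<in> {0..T} \<Longrightarrow> bR t = 0"
    and "\<alpha>L\<^sup>2 + \<beta>L\<^sup>2 \<noteq> 0" and "\<alpha>R\<^sup>2 + \<beta>R\<^sup>2 \<noteq> 0"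
    and "\<alpha>L * \<beta>L \<le> 0" and "\<alpha>R * \<beta>R \<ge> 0"
    and "\<alpha>L \<noteq> 0" and "\<alpha>R \<noteq> 0"
  shows "\<forall>t\<in>{0..T}.
    semi_discrete_energy N (Dm N) (H N) C T u t
      + integral {0..t} (boundary_term N \<alpha>L \<beta>L \<alpha>R \<beta>R T u)
    \<le> semi_discrete_energy N (Dm N) (H N) C T u 0
      + 1 / \<delta> * integral {0..t} (\<lambda>s. (norm_H (H N) (mat_inv C *\<^sub>v S s))\<^sup>2)"
proof
  fix t assume t: "t \<in> {0..T}"
  have N2: "2 \<le> N" and sbp: "dp_sbp_at xL xR p N (Dm N) (Dp N) (H N)"
    using assms(6,7) by (auto simp: dp_sbp_def)
  obtain w where H: "H N = mat_diag N w" using sbp by (auto simp: dp_sbp_at_def)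
  have w: "0 < w i" if "i < N" for i
    using sbp that pos_def_mat_diag_pos by (auto simp: dp_sbp_at_def H)
  have Dm: "Dm N \<in> carrier_mat N N" and Dp: "Dp N \<in> carrier_mat N N"
    using sbp by (auto simp: dp_sbp_at_def)
  define d where "d i = c (grid_pt xL xR N i)" for i
  define s where "s i = \<sigma> (grid_pt xL xR N i)" for i
  have C: "C = mat_diag N d" and \<Sigma>: "\<Sigma> = mat_diag N s"
    by (simp_all add: C_def \<Sigma>_def grid_diag_def d_def[abs_def] s_def[abs_def])
  \<comment> \<open>The wave speed is assumed nonzero on the interval, so the grid points must be
    shown to lie in it.\<close>
  have d: "d i \<noteq> 0" if i: "i < N" for i
  proof -
    have "real i / (real N - 1) \<le> 1" using i N2 by simp
    then have "real i / (real N - 1) * (xR - xL) \<le> 1 * (xR - xL)"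
      using \<open>xL < xR\<close> by (intro mult_right_mono) auto
    moreover have "0 \<le> real i / (real N - 1) * (xR - xL)" using \<open>xL < xR\<close> N2 by simp
    ultimately have "grid_pt xL xR N i \<in> {xL..xR}"
      by (simp add: grid_pt_def grid_step_def)
    then show ?thesis unfolding d_def by (rule assms(8))
  qed
  have Cinv: "mat_inv C *\<^sub>v x = vec N (\<lambda>i. x $ i / d i)" if "x \<in> carrier_vec N" for x
    using that by (simp add: C mat_inv_mat_diag d mat_diag_mult_vec)
  note sol = assms(14)[unfolded semi_discrete_solution_def]
  define v where "v = ddt N T u"
  define a where "a = ddt N T v"
  have v [simp]: "v r \<in> carrier_vec N" and a [simp]: "a r \<in> carrier_vec N" for r
    by (simp_all add: v_def a_def)
  have u: "u r \<in> carrier_vec N" if "r \<in> {0..T}" for r using sol that by blast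
  have du: "((\<lambda>r. u r $ i) has_vector_derivative v r $ i) (at r within {0..T})"
    and dv: "((\<lambda>r. v r $ i) has_vector_derivative a r $ i) (at r within {0..T})"
    if "i < N" "r \<in> {0..T}" for i r
    using sol that vec_differentiable_has_vector_derivative by (auto simp: v_def a_def)
  \<comment> \<open>\<open>E\<close> is the energy as an explicit sum, equal to
    \<open>semi_discrete_energy\<close> on [0,T], where \<open>u r\<close> has dimension
    \<open>N\<close>; \<open>E'\<close> is its derivative there.\<close>
  define E where "E r = 1 / 2 * ((\<Sum>i<N. w i * (v r $ i / d i)\<^sup>2)
    + (\<Sum>i<N. w i * ((Dm N *\<^sub>v u r) $ i)\<^sup>2))" for r
  define E' where "E' r = (\<Sum>i<N. w i * (v r $ i / d i) * (a r $ i / d i))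
    + (\<Sum>i<N. w i * (Dm N *\<^sub>v u r) $ i * (Dm N *\<^sub>v v r) $ i)" for r
  define BT where "BT = boundary_term N \<alpha>L \<beta>L \<alpha>R \<beta>R T u"
  define F where "F r = (norm_H (H N) (mat_inv C *\<^sub>v S r))\<^sup>2" for r
  have E: "semi_discrete_energy N (Dm N) (H N) C T u r = E r" if "r \<in> {0..T}" for r
    unfolding semi_discrete_energy_def E_def H v_def[symmetric] Cinv[OF v]
    using w Dm u[OF that]
    by (simp add: norm_H_mat_diag_sq less_imp_le mult_mat_vec_carrier)
  have F: "F r = (\<Sum>i<N. w i * (S r $ i / d i)\<^sup>2)" if "r \<in> {0..T}" for r
    unfolding F_def H Cinv[OF assms(10)[OF that]] using w
    by (simp add: norm_H_mat_diag_sq less_imp_le)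
  have dE: "(E has_vector_derivative E' r) (at r within {0..T})" if r: "r \<in> {0..T}" for r
  proof -
    \<comment> \<open>The factor 2 stands in front so that it can be pulled out of both sums and
      cancelled against the 1/2 of the energy.\<close>
    have sq: "((\<lambda>r. k * (y r)\<^sup>2) has_vector_derivative 2 * (k * y r * y')) (at r within {0..T})"
      if "(y has_vector_derivative y') (at r within {0..T})" for k y' :: real and y
      using that unfolding has_real_derivative_iff_has_vector_derivative[symmetric]
      by (auto intro!: derivative_eq_intros)
    have half: "1 / 2 * (2 * x + 2 * y) = x + y" for x y :: real by simp
    have "((\<lambda>r. v r $ i / d i) has_vector_derivative a r $ i / d i) (at r within {0..T})"
      if "i < N" for i
      using has_vector_derivative_mult_right[OF dv[OF that r], of "1 / d i"] by simp
    moreover have "((\<lambda>r. (Dm N *\<^sub>v u r) $ i) has_vector_derivative (Dm N *\<^sub>v v r) $ i)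
        (at r within {0..T})" if "i < N" for i
      using that r u du by (intro mult_mat_vec_has_vector_derivative[OF Dm]) auto
    ultimately have "(E has_vector_derivative 1 / 2 *
        ((\<Sum>i<N. 2 * (w i * (v r $ i / d i) * (a r $ i / d i)))
        + (\<Sum>i<N. 2 * (w i * (Dm N *\<^sub>v u r) $ i * (Dm N *\<^sub>v v r) $ i)))) (at r within {0..T})"
      unfolding E_def[abs_def]
      by (intro has_vector_derivative_mult_right has_vector_derivative_add
          has_vector_derivative_sum sq) auto
    moreover have "1 / 2 *
        ((\<Sum>i<N. 2 * (w i * (v r $ i / d i) * (a r $ i / d i)))
        + (\<Sum>i<N. 2 * (w i * (Dm N *\<^sub>v u r) $ i * (Dm N *\<^sub>v v r) $ i))) = E' r"
      unfolding E'_def sum_distrib_left[symmetric] by (rule half)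
    ultimately show ?thesis by (simp only:)
  qed
  \<comment> \<open>For the gauge integral, being a derivative at every point already makes
    \<open>E'\<close> integrable.\<close>
  have intE: "(E' has_integral (E t - E 0)) {0..t}"
    using t by (intro fundamental_theorem_of_calculus)
      (auto intro!: has_vector_derivative_within_subset[OF dE])
  \<comment> \<open>\<open>integral\<close> is 0 by default on non-integrable functions, so
    integrability of \<open>BT\<close> and \<open>F\<close> has to be established; for
    \<open>BT\<close> it comes from the differentiability of \<open>v\<close>.\<close>
  have "continuous_on {0..T} (\<lambda>r. v r $ i)" if "i < N" for i
    unfolding continuous_on_eq_continuous_within
    by (intro ballI) (rule has_vector_derivative_continuous[OF dv[OF that]])
  then have "continuous_on {0..T} BT"
    unfolding BT_def boundary_term_def[abs_def] v_def[symmetric]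
    using N2 by (intro continuous_intros) auto
  then have intBT: "BT integrable_on {0..t}"
    by (intro integrable_continuous_interval) (rule continuous_on_subset, use t in auto)
  have "continuous_on {0..T} (\<lambda>r. \<Sum>i<N. w i * (S r $ i / d i)\<^sup>2)"
    using assms(11) d by (intro continuous_intros) auto
  then have "continuous_on {0..T} F" by (rule continuous_on_eq) (simp add: F)
  then have intF: "F integrable_on {0..t}"
    by (intro integrable_continuous_interval) (rule continuous_on_subset, use t in auto)
  define m where "m = Min ((\<lambda>i. (s i)\<^sup>2) ` {..<N})"
  have \<delta>: "\<delta> = 2 * m" by (simp add: \<delta>_def m_def s_def)
  \<comment> \<open>A minimum of finitely many positive squares; \<open>N2\<close> makes the index
    set nonempty.\<close>
  have m: "0 < m" using N2 assms(9) unfolding m_def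
    by (subst Min_gr_iff) (auto simp: s_def lessThan_empty_iff)
  have "E' r + BT r \<le> 1 / \<delta> * F r" if r: "r \<in> {0..T}" for r
  proof -
    have "E' r + BT r
        = (\<Sum>i<N. w i * ((v r $ i / d i) * (S r $ i / d i) - (s i)\<^sup>2 * (v r $ i / d i)\<^sup>2))"
      unfolding E'_def BT_def boundary_term_def v_def[symmetric]
    proof (rule semi_discrete_energy_rate[OF H w C d \<Sigma> Dm Dp])
      show "a r + (\<Sigma> ^\<^sub>m 2) *\<^sub>v v r = (C ^\<^sub>m 2) *\<^sub>v (Dp N *\<^sub>v (Dm N *\<^sub>v u r)) + S r
          + sat_term N (Dm N) (H N) C 0 1 \<alpha>L \<beta>L 0 (u r) (v r)
          + sat_term N (Dm N) (H N) C (N - 1) (- 1) \<alpha>R \<beta>R 0 (u r) (v r)"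
        using sol r assms(15-18) by (simp add: v_def a_def)
    qed (use sbp N2 u[OF r] assms(10)[OF r] in \<open>auto simp: dp_sbp_at_def\<close>)
    \<comment> \<open>Young's inequality at each node with \<open>x = v r $ i / d i\<close>,
      \<open>y = S r $ i / d i\<close> and \<open>k = (s i)\<^sup>2\<close>; positive weights
      preserve it.\<close>
    also have "\<dots> \<le> (\<Sum>i<N. w i * (1 / \<delta> * (S r $ i / d i)\<^sup>2))"
    proof (intro sum_mono mult_left_mono)
      fix i assume i: "i \<in> {..<N}"
      then have "m \<le> (s i)\<^sup>2" unfolding m_def by (intro Min_le) auto
      with m show "(v r $ i / d i) * (S r $ i / d i) - (s i)\<^sup>2 * (v r $ i / d i)\<^sup>2
          \<le> 1 / \<delta> * (S r $ i / d i)\<^sup>2"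
        unfolding \<delta> by (rule mult_diff_square_le)
      show "0 \<le> w i" using w[of i] i by simp
    qed
    also have "\<dots> = 1 / \<delta> * F r"
      unfolding F[OF r] sum_distrib_left by (intro sum.cong) (auto simp: mult_ac)
    finally show ?thesis .
  qed
  then have "E t - E 0 + integral {0..t} BT \<le> 1 / \<delta> * integral {0..t} F"
    using t by (intro has_integral_le[OF has_integral_add[OF intE integrable_integral[OF intBT]]
          has_integral_mult_right[OF integrable_integral[OF intF]]]) auto
  then show "semi_discrete_energy N (Dm N) (H N) C T u t
      + integral {0..t} (boundary_term N \<alpha>L \<beta>L \<alpha>R \<beta>R T u)
    \<le> semi_discrete_energy N (Dm N) (H N) C T u 0
      + 1 / \<delta> * integral {0..t} (\<lambda>s. (norm_H (H N) (mat_inv C *\<^sub>v S s))\<^sup>2)"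
    using t \<open>0 < T\<close> by (simp add: E BT_def F_def[abs_def])
qed

end
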